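(* Let $G=\mathrm{GIRG}(n,\beta,w_0,d)$ be a standard GIRG with $d=\omega(\log n)$ and let $U_k=\{v_1,\dots,v_k\}$ be a set of $k$ vertices chosen uniformly at random, with weights $w_1,\dots,w_k$. For any constant $k\in\mathbb{N}_{\ge3}$, any $\mathcal{A}\subseteq\binom{U_k}{2}$ and sufficiently large $n$, $$\Pr\Big[E(U_k)\supseteq\mathcal{A}\ \Big|\ \{\kappa\}^{(k)}\Big]\le\Big(1-\Big(\frac{\kappa_0}{n}\Big)^{r/d}\sum_{\{i,j\}\in\mathcal{A}}\Big(1-\Big(\frac{\kappa_{ij}}{n}\Big)^{1/d}\Big)\Big)^d,$$ where $r=(3(k-2)+1)(k-1)$.
   Context: Fix constants $\lambda>0$, $w_0>0$, $\beta>2$. A standard GIRG $\mathrm{GIRG}(n,\beta,w_0,d)$ has $n$ vertices; each vertex $v$ independently receives a weight $w_v$ with $\Pr[w_v\le x]=1-(x/w_0)^{1-\beta}$ for $x\ge w_0$, and independently a position $\mathbf{x}_v$ uniform on the torus $\mathbb{T}^d=[0,1)^d$. The distance is $d(\mathbf{x}_u,\mathbf{x}_v)=\max_{1\le i\le d}|x_{ui}-x_{vi}|_C$ with $|a-b|_C=\min\{|a-b|,1-|a-b|\}$. Distinct $u,v$ are adjacent iff $d(\mathbf{x}_u,\mathbf{x}_v)\le \frac12\big(\frac{\lambda w_uw_v}{n}\big)^{1/d}$. The dimension $d=d(n)$ depends on $n$. Notation: $\kappa_{ij}=\min\{\lambda w_iw_j,n\}$, $\{\kappa\}^{(k)}=\{\kappa_{ij}\mid1\le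 i<j\le k\}$, $\kappa_0=\lambda w_0^2$, and $E(U_k)$ is the (random) set of edges of $G$ among vertices of $U_k$. *)

theory Defs
  imports "HOL-Probability.Probability"
begin

definition weight_law :: "real \<Rightarrow> real \<Rightarrow> real measure" where
  "weight_law \<beta> w0 =
     interval_measure (\<lambda>x. if x < w0 then 0 else 1 - (x / w0) powr (1 - \<beta>))"

text \<open>The dimension varies with the number of vertices, so a point of the torus is a function
  on \<open>{1..d}\<close> rather than an element of a type-indexed vector space.\<close>

definition torus_law :: "nat \<Rightarrow> (nat \<Rightarrow> real) measure" where
  "torus_law d =
     uniform_measure (\<Pi>\<^sub>M i\<in>{1..d}. lborel) (\<Pi>\<^sub>E i\<in>{1..d}. {0..<1})"

definition circ_dist :: "real \<Rightarrow> real \<Rightarrow> real" where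
  "circ_dist a b = min \<bar>a - b\<bar> (1 - \<bar>a - b\<bar>)"

definition torus_dist :: "nat \<Rightarrow> (nat \<Rightarrow> real) \<Rightarrow> (nat \<Rightarrow> real) \<Rightarrow> real" where
  "torus_dist d x y = (MAX i\<in>{1..d}. circ_dist (x i) (y i))"

definition girg_edges ::
  "real \<Rightarrow> nat \<Rightarrow> nat \<Rightarrow> (nat \<Rightarrow> real) \<Rightarrow> (nat \<Rightarrow> nat \<Rightarrow> real) \<Rightarrow> nat set set" where
  "girg_edges lam n d w x =
     {{u, v} | u v. u \<in> {1..n} \<and> v \<in> {1..n} \<and> u \<noteq> v \<and>
        torus_dist d (x u) (x v) \<le> 1 / 2 * (lam * w u * w v / real n) powr (1 / real d)}"

definition induced_edges :: "'v set set \<Rightarrow> 'v set \<Rightarrow> 'v set set" where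
  "induced_edges E U = {e \<in> E. e \<subseteq> U}"

text \<open>An outcome is a triple \<open>(w, x, v)\<close>: weights and positions of the vertices \<open>{1..n}\<close>, and an
  independent tuple \<open>v 1, \<dots>, v k\<close> that is uniform among all \<open>k\<close>-tuples of distinct vertices;
  hence \<open>v ` {1..k}\<close> is uniform among all sets of \<open>k\<close> vertices.\<close>

type_synonym girg_outcome = "(nat \<Rightarrow> real) \<times> (nat \<Rightarrow> nat \<Rightarrow> real) \<times> (nat \<Rightarrow> nat)"

definition girg_space :: "real \<Rightarrow> real \<Rightarrow> nat \<Rightarrow> nat \<Rightarrow> nat \<Rightarrow> girg_outcome measure" where
  "girg_space \<beta> w0 n d k =
     (\<Pi>\<^sub>M u\<in>{1..n}. weight_law \<beta> w0) \<Otimes>\<^sub>M (\<Pi>\<^sub>M u\<in>{1..n}. torus_law d) \<Otimes>\<^sub>M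
     uniform_count_measure {v \<in> {1..k} \<rightarrow>\<^sub>E {1..n}. inj_on v {1..k}}"

definition kappa :: "real \<Rightarrow> nat \<Rightarrow> nat \<Rightarrow> nat \<Rightarrow> girg_outcome \<Rightarrow> real" where
  "kappa lam n i j = (\<lambda>(w, x, v). min (lam * w (v i) * w (v j)) (real n))"

definition index_pairs :: "nat \<Rightarrow> (nat \<times> nat) set" where
  "index_pairs k = {(i, j). 1 \<le> i \<and> i < j \<and> j \<le> k}"

text \<open>The sub-\<open>\<sigma>\<close>-algebra generated by the random variables \<open>kappa lam n i j\<close>
  with \<open>1 \<le> i < j \<le> k\<close>.\<close>

definition kappa_algebra :: "real \<Rightarrow> nat \<Rightarrow> nat \<Rightarrow> girg_outcome measure \<Rightarrow> girg_outcome measure" where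
  "kappa_algebra lam n k M =
     vimage_algebra (space M) (\<lambda>\<omega>. \<lambda>(i, j)\<in>index_pairs k. kappa lam n i j \<omega>)
       (\<Pi>\<^sub>M p\<in>index_pairs k. borel)"

text \<open>A set of unordered pairs of the sampled vertices is given by a set of index pairs
  \<open>A \<subseteq> index_pairs k\<close>, where \<open>(i, j)\<close> stands for \<open>{v i, v j}\<close>.\<close>

definition contains_edges ::
  "real \<Rightarrow> nat \<Rightarrow> nat \<Rightarrow> nat \<Rightarrow> (nat \<times> nat) set \<Rightarrow> girg_outcome \<Rightarrow> bool" where
  "contains_edges lam n d k A = (\<lambda>(w, x, v).
     (\<lambda>(i, j). {v i, v j}) ` A \<subseteq> induced_edges (girg_edges lam n d w x) (v ` {1..k}))"

definition prob_given :: "'a measure \<Rightarrow> 'a measure \<Rightarrow> ('a \<Rightarrow> bool) \<Rightarrow> 'a \<Rightarrow> real" where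
  "prob_given M F P = real_cond_exp M F (indicat_real {\<omega> \<in> space M. P \<omega>})"

end

theory Submission
  imports Defs
begin

text \<open>
  Given the weights, the \<open>d\<close> coordinates of the positions are independent and identically distributed,
  so the probability is \<open>p ^ d\<close>, where \<open>p\<close> is the probability that no pair in \<open>A\<close> is too far apart in
  one coordinate. On the circle the pair \<open>{i, j}\<close> is too far apart with probability
  \<open>\<epsilon>\<^sub>i\<^sub>j = 1 - (\<kappa>\<^sub>i\<^sub>j / n) powr (1 / d)\<close>, and by rotation invariance these events are pairwise independent,
  even for pairs that share a vertex. With \<open>S\<close> the sum of the \<open>\<epsilon>\<^sub>i\<^sub>j\<close>, Bonferroni's inequality gives
  \<open>p \<le> 1 - S + S\<^sup>2 / 2\<close>. Each \<open>\<epsilon>\<^sub>i\<^sub>j\<close> is at most \<open>1 - q\<close> for \<open>q = (\<kappa>\<^sub>0 / n) powr (1 / d)\<close>, and \<open>q\<close> tends to 1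
  because \<open>d\<close> dominates \<open>ln n\<close>; hence \<open>1 - S / 2 \<ge> q powr r\<close> for large \<open>n\<close>, as \<open>r\<close> exceeds half the
  number of pairs.
\<close>

section \<open>Conditional expectations, Bonferroni's inequality and independent coordinates\<close>

text \<open>The set where the conditional expectation exceeds \<open>g\<close> is itself in
  \<open>F\<close>. The hypothesis on that set says that a nonnegative function has integral at most
  0, so the set is null.\<close>

lemma (in sigma_finite_subalgebra) real_cond_exp_leI:
  assumes f: "integrable M f" and g: "integrable M g" and gF: "g \<in> borel_measurable F"
    and le: "\<And>B. B \<in> sets F \<Longrightarrow> (\<integral>x\<in>B. f x \<partial>M) \<le> (\<integral>x\<in>B. g x \<partial>M)"
  shows "AE x in M. real_cond_exp M F f x \<le> g x"
proof -
  let ?c = "real_cond_exp M F f"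
  define B where "B = {x \<in> space F. g x < ?c x}"
  have BF: "B \<in> sets F"
    unfolding B_def using gF by measurable
  then have BM: "B \<in> sets M"
    using subalg by (auto simp: subalgebra_def)
  have c: "integrable M ?c"
    using f by (rule real_cond_exp_int)
  have [simp]: "set_integrable M B ?c" "set_integrable M B g"
    unfolding set_integrable_def using c g BM by (simp_all only: integrable_mult_indicator)
  have "(\<integral>x\<in>B. ?c x - g x \<partial>M) = (\<integral>x\<in>B. f x \<partial>M) - (\<integral>x\<in>B. g x \<partial>M)"
    by (simp add: real_cond_exp_intA[OF f BF])
  also have "\<dots> \<le> 0"
    using le[OF BF] by simp
  finally have "(\<integral>x. indicator B x * (?c x - g x) \<partial>M) \<le> 0"
    by (simp add: set_lebesgue_integral_def)
  moreover have nn: "0 \<le> indicator B x * (?c x - g x)" for x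
    by (auto simp: B_def indicator_def)
  moreover have "integrable M (\<lambda>x. indicator B x * (?c x - g x))"
    using integrable_mult_indicator[OF BM Bochner_Integration.integrable_diff[OF c g]] by simp
  ultimately have "AE x in M. indicator B x * (?c x - g x) = 0"
    by (subst integral_nonneg_eq_0_iff_AE[symmetric])
       (auto intro!: antisym integral_nonneg simp: nn)
  then show ?thesis
    using AE_space
    by eventually_elim (use subalg in \<open>auto simp: B_def subalgebra_def indicator_def split: if_splits\<close>)
qed

text \<open>Second-order Bonferroni: pairwise independence turns the subtracted intersections into
  products, and the sum of \<open>p e * p e'\<close> over unordered pairs is at most half the square
  of the sum.\<close>

lemma (in prob_space) prob_Union_ge_pairwise_indep:
  assumes "finite E"
    and "\<And>e. e \<in> E \<Longrightarrow> B e \<in> events"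
    and "\<And>e. e \<in> E \<Longrightarrow> prob (B e) = p e"
    and "\<And>e e'. e \<in> E \<Longrightarrow> e' \<in> E \<Longrightarrow> e \<noteq> e' \<Longrightarrow> prob (B e \<inter> B e') = p e * p e'"
  shows "prob (\<Union>e\<in>E. B e) \<ge> sum p E - (sum p E)\<^sup>2 / 2"
  using assms
proof (induction E)
  case empty
  then show ?case by simp
next
  case (insert e E)
  let ?U = "\<Union>e\<in>E. B e" and ?S = "sum p E"
  have ev: "?U \<in> events" "B e \<in> events"
    using insert.hyps insert.prems(1) by auto
  have "prob (B e \<inter> ?U) = prob (\<Union>e'\<in>E. B e \<inter> B e')"
    by (simp only: Int_UN_distrib)
  also have "\<dots> \<le> (\<Sum>e'\<in>E. prob (B e \<inter> B e'))"
    using insert.hyps insert.prems(1) by (intro finite_measure_subadditive_finite) auto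
  also have "\<dots> = (\<Sum>e'\<in>E. p e * p e')"
    using insert.hyps by (intro sum.cong refl insert.prems(3)) auto
  also have "\<dots> = p e * ?S"
    by (simp add: sum_distrib_left)
  finally have "prob (B e \<inter> ?U) \<le> p e * ?S" .
  moreover have "prob (B e \<union> ?U) = prob (B e) + prob ?U - prob (B e \<inter> ?U)"
  proof -
    have "prob (B e \<union> ?U) = prob (B e) + prob (?U - B e)"
      using ev by (intro measure_Un2)  (auto simp: fmeasurable_eq_sets)
    moreover have "prob (?U - B e) = prob ?U - prob (B e \<inter> ?U)"
      using ev by (subst finite_measure_Diff') (auto simp: Int_commute)
    ultimately show ?thesis by simp
  qed
  moreover have "prob ?U \<ge> ?S - ?S\<^sup>2 / 2"
    using insert by auto
  moreover have "prob (B e) = p e"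
    using insert.prems by auto
  moreover have "(p e)\<^sup>2 \<ge> 0"
    by simp
  \<comment> \<open>Expanding the square reproduces the overlap bound \<open>p e * ?S\<close>
    exactly; the only slack is half the square of \<open>p e\<close>, which has the right
    sign.\<close>
  moreover have "(p e + ?S) - (p e + ?S)\<^sup>2 / 2 = p e + ?S - ?S\<^sup>2 / 2 - p e * ?S - (p e)\<^sup>2 / 2"
    by (simp add: power2_sum add_divide_distrib)
  ultimately have "(p e + ?S) - (p e + ?S)\<^sup>2 / 2 \<le> prob (B e \<union> ?U)"
    by linarith
  then show ?case
    using insert.hyps by simp
qed

text \<open>Integrating one vertex at a time turns a product over the coordinates into a product of
  one-coordinate functions, so induction on the set of vertices exchanges the two products.\<close>

lemma nn_integral_prod_coordinates:
  fixes N :: "'a measure" and J :: "'u set" and K :: "'l set"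
  assumes "prob_space N" and "finite J" and K: "finite K"
    and "\<And>l. l \<in> K \<Longrightarrow> f l \<in> borel_measurable (PiM J (\<lambda>_. N))"
  shows "(\<integral>\<^sup>+x. (\<Prod>l\<in>K. f l (\<lambda>u\<in>J. x u l)) \<partial>PiM J (\<lambda>_. PiM K (\<lambda>_. N)))
    = (\<Prod>l\<in>K. \<integral>\<^sup>+z. f l z \<partial>PiM J (\<lambda>_. N))"
  using assms(2,4)
proof (induction J arbitrary: f)
  case empty
  interpret N: product_sigma_finite "\<lambda>_. N"
    using assms(1) by (simp add: product_sigma_finite_def prob_space_imp_sigma_finite)
  interpret NK: product_sigma_finite "\<lambda>_. PiM K (\<lambda>_. N)"
    using assms(1) by (simp add: product_sigma_finite_def prob_space_imp_sigma_finite prob_space_PiM)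
  show ?case
    by (simp add: NK.nn_integral_empty N.nn_integral_empty restrict_def del: nn_integral_const)
next
  case (insert j J)
  interpret prob_space N by fact
  interpret N: product_sigma_finite "\<lambda>_. N"
    using assms(1) by (simp add: product_sigma_finite_def prob_space_imp_sigma_finite)
  interpret NK: product_sigma_finite "\<lambda>_. PiM K (\<lambda>_. N)"
    using assms(1) by (simp add: product_sigma_finite_def prob_space_imp_sigma_finite prob_space_PiM)
  let ?P = "PiM J (\<lambda>_. PiM K (\<lambda>_. N))"
  \<comment> \<open>Vertex \<open>j\<close> is integrated out of each one-coordinate function
    separately. The induction hypothesis is applied to these new functions, hence the generalisation
    over \<open>f\<close>.\<close>
  define f' where "f' l z = (\<integral>\<^sup>+t. f l (z(j := t)) \<partial>N)" for l z
  have f[measurable]: "f l \<in> borel_measurable (PiM (insert j J) (\<lambda>_. N))" if "l \<in> K" for l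
    using insert.prems that by auto
  have slice[measurable]: "(\<lambda>x. \<lambda>u\<in>J'. x u l) \<in> PiM J' (\<lambda>_. PiM K (\<lambda>_. N)) \<rightarrow>\<^sub>M PiM J' (\<lambda>_. N)"
    if "l \<in> K" for l and J' :: "'u set"
  proof (rule measurable_restrict)
    fix u assume "u \<in> J'"
    then show "(\<lambda>x. x u l) \<in> PiM J' (\<lambda>_. PiM K (\<lambda>_. N)) \<rightarrow>\<^sub>M N"
      by (rule measurable_compose[OF measurable_component_singleton, where g = "\<lambda>y. y l"])
         (rule measurable_component_singleton[OF that])
  qed
  have f': "f' l \<in> borel_measurable (PiM J (\<lambda>_. N))" if "l \<in> K" for l
    unfolding f'_def using that by measurable
  have prodm: "(\<lambda>x. \<Prod>l\<in>K. f l (\<lambda>u\<in>insert j J. x u l))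
      \<in> borel_measurable (PiM (insert j J) (\<lambda>_. PiM K (\<lambda>_. N)))"
    by (intro borel_measurable_prod_ennreal measurable_compose[OF slice f])
  \<comment> \<open>Factor \<open>l\<close> sees the position \<open>y\<close> of vertex
    \<open>j\<close> only through \<open>y l\<close>, so the integral over all coordinates of that
    position factors.\<close>
  have upd: "(\<lambda>u\<in>insert j J. (x(j := y)) u l) = (\<lambda>u\<in>J. x u l)(j := y l)" for x and y :: "'l \<Rightarrow> 'a" and l
    by (auto simp: fun_eq_iff restrict_def)
  have fz: "(\<lambda>t. f l (z(j := t))) \<in> borel_measurable N"
    if "l \<in> K" "z \<in> space (PiM J (\<lambda>_. N))" for l z
    using that by (intro measurable_compose[OF _ f] measurable_fun_upd[where J = J]) auto
  have "(\<integral>\<^sup>+x. (\<Prod>l\<in>K. f l (\<lambda>u\<in>insert j J. x u l)) \<partial>PiM (insert j J) (\<lambda>_. PiM K (\<lambda>_. N)))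
      = (\<integral>\<^sup>+x. \<integral>\<^sup>+y. (\<Prod>l\<in>K. f l ((\<lambda>u\<in>J. x u l)(j := y l))) \<partial>PiM K (\<lambda>_. N) \<partial>?P)"
    by (subst NK.product_nn_integral_insert[OF insert.hyps prodm]) (simp only: upd)
  also have "\<dots> = (\<integral>\<^sup>+x. (\<Prod>l\<in>K. f' l (\<lambda>u\<in>J. x u l)) \<partial>?P)"
  proof (intro nn_integral_cong)
    fix x assume x: "x \<in> space ?P"
    have "(\<lambda>u\<in>J. x u l) \<in> space (PiM J (\<lambda>_. N))" if "l \<in> K" for l
      using measurable_space[OF slice x] that by auto
    then show "(\<integral>\<^sup>+y. (\<Prod>l\<in>K. f l ((\<lambda>u\<in>J. x u l)(j := y l))) \<partial>PiM K (\<lambda>_. N))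
        = (\<Prod>l\<in>K. f' l (\<lambda>u\<in>J. x u l))"
      unfolding f'_def
      by (intro N.product_nn_integral_prod[OF K, of "\<lambda>l t. f l ((\<lambda>u\<in>J. x u l)(j := t))"] fz) auto
  qed
  also have "\<dots> = (\<Prod>l\<in>K. \<integral>\<^sup>+z. f' l z \<partial>PiM J (\<lambda>_. N))"
    by (intro insert.IH f')
  also have "\<dots> = (\<Prod>l\<in>K. \<integral>\<^sup>+z. f l z \<partial>PiM (insert j J) (\<lambda>_. N))"
    unfolding f'_def by (intro prod.cong refl N.product_nn_integral_insert[symmetric] insert.hyps f)
  finally show ?case .
qed

section \<open>The uniform laws on the circle and the torus\<close>

text \<open>The law of one coordinate. Its space is the whole real line, which avoids side
  conditions in measurability proofs; in return, \<open>0 \<le> x\<close> and \<open>x < 1\<close>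
  are known only almost everywhere.\<close>

definition circle_law :: "real measure" where
  "circle_law = uniform_measure lborel {0..<1}"

lemma space_circle_law [simp]: "space circle_law = UNIV"
  and sets_circle_law [simp, measurable_cong]: "sets circle_law = sets borel"
  by (simp_all add: circle_law_def)

lemma emeasure_circle_law: "B \<in> sets borel \<Longrightarrow> emeasure circle_law B = emeasure lborel ({0..<1} \<inter> B)"
  by (simp add: circle_law_def divide_ennreal_def)

lemma prob_space_circle_law: "prob_space circle_law"
  unfolding circle_law_def by (rule prob_space_uniform_measure) auto

lemma AE_circle_law: "AE x in circle_law. 0 \<le> x \<and> x < 1"
  unfolding circle_law_def by (rule AE_uniform_measureI) auto

text \<open>The unit cube has Lebesgue measure 1, so conditioning on it merely cuts each side of a
  box down to \<open>{0..<1}\<close>. Both measures thus agree on boxes, which determine the product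
  measure.\<close>

lemma torus_law_eq_PiM: "torus_law d = PiM {1..d} (\<lambda>_. circle_law)"
proof -
  interpret C: product_sigma_finite "\<lambda>_. circle_law"
    by (simp add: product_sigma_finite_def prob_space_imp_sigma_finite prob_space_circle_law)
  interpret L: product_sigma_finite "\<lambda>_. lborel :: real measure"
    by (simp add: product_sigma_finite_def lborel.sigma_finite_measure_axioms)
  have box: "emeasure (PiM {1..d} (\<lambda>_. lborel)) (\<Pi>\<^sub>E i\<in>{1..d}. {0..<1::real}) = 1"
    by (subst L.emeasure_PiM) auto
  show ?thesis
  proof (rule C.PiM_eqI)
    show "sets (torus_law d) = sets (PiM {1..d} (\<lambda>_. circle_law))"
      unfolding torus_law_def by (simp cong: sets_PiM_cong)
  next
    fix A :: "nat \<Rightarrow> real set" assume A: "\<And>i. i \<in> {1..d} \<Longrightarrow> A i \<in> sets circle_law"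
    have "emeasure (torus_law d) (Pi\<^sub>E {1..d} A)
        = emeasure (PiM {1..d} (\<lambda>_. lborel)) (\<Pi>\<^sub>E i\<in>{1..d}. {0..<1} \<inter> A i)"
      unfolding torus_law_def using A
      by (subst emeasure_uniform_measure) (auto simp: box[simplified] divide_ennreal_def PiE_Int intro!: sets_PiM_I_finite)
    also have "\<dots> = (\<Prod>i\<in>{1..d}. emeasure lborel ({0..<1} \<inter> A i))"
      using A by (intro L.emeasure_PiM) auto
    also have "\<dots> = (\<Prod>i\<in>{1..d}. emeasure circle_law (A i))"
      using A by (intro prod.cong refl) (simp add: emeasure_circle_law)
    finally show "emeasure (torus_law d) (Pi\<^sub>E {1..d} A) = (\<Prod>i\<in>{1..d}. emeasure circle_law (A i))" .
  qed simp
qed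

section \<open>Far-apart pairs in a single coordinate\<close>

lemma measurable_circ_dist [measurable]: "(\<lambda>(a, b). circ_dist a b) \<in> borel_measurable (borel \<Otimes>\<^sub>M borel)"
  unfolding circ_dist_def by measurable

lemma circ_dist_commute: "circ_dist a b = circ_dist b a"
  by (simp add: circ_dist_def abs_minus_commute)

text \<open>The points within distance \<open>t\<close> of \<open>a\<close> form an arc of length
  \<open>2 * t\<close> wherever \<open>a\<close> lies; this is the rotation invariance behind
  pairwise independence. The cases are an arc covering the circle, one reaching below 0, one inside
  \<open>{0..<1}\<close>, and one reaching 1 or beyond.\<close>

lemma emeasure_circ_dist_gt:
  assumes a: "0 \<le> a" "a < 1" and t: "0 \<le> t"
  shows "emeasure circle_law {y. t < circ_dist a y} = ennreal (max 0 (1 - 2 * t))"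
proof -
  have eq: "emeasure circle_law {y. t < circ_dist a y} = emeasure lborel {y. 0 \<le> y \<and> y < 1 \<and> t < circ_dist a y}"
    by (subst emeasure_circle_law) (auto intro!: arg_cong2[where f = emeasure])
  consider "1 / 2 \<le> t" | "t < 1 / 2" "a < t" | "t < 1 / 2" "t \<le> a" "a < 1 - t" | "t < 1 / 2" "1 - t \<le> a"
    by linarith
  then show ?thesis
  proof cases
    case 1
    then have "{y. 0 \<le> y \<and> y < 1 \<and> t < circ_dist a y} = {}"
      by (auto simp: circ_dist_def)
    then show ?thesis
      using 1 unfolding eq by (simp only: emeasure_empty) simp
  next
    case 2
    then have "{y. 0 \<le> y \<and> y < 1 \<and> t < circ_dist a y} = {a + t<..<a + 1 - t}"
      using a t by (auto simp: circ_dist_def min_def abs_if split: if_splits)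
    then show ?thesis
      using 2 unfolding eq by simp
  next
    case 3
    then have *: "{y. 0 \<le> y \<and> y < 1 \<and> t < circ_dist a y} = {0..<a - t} \<union> {a + t<..<1}"
      using a t by (auto simp: circ_dist_def min_def abs_if split: if_splits)
    have "emeasure lborel ({0..<a - t} \<union> {a + t<..<1}) = ennreal (a - t) + ennreal (1 - (a + t))"
      using a t 3 by (subst plus_emeasure[symmetric]) auto
    also have "\<dots> = ennreal (1 - 2 * t)"
      using 3 by (subst ennreal_plus[symmetric]) (auto intro!: arg_cong[where f = ennreal])
    finally show ?thesis
      using 3 unfolding eq * by simp
  next
    case 4
    then have "{y. 0 \<le> y \<and> y < 1 \<and> t < circ_dist a y} = {a - 1 + t<..<a - t}"
      using a t by (auto simp: circ_dist_def min_def abs_if split: if_splits)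
    then show ?thesis
      using 4 unfolding eq by simp
  qed
qed

text \<open>Since \<open>h\<close> ignores coordinate \<open>j\<close>, that coordinate can be
  integrated first. The inner integral has the same value for every \<open>z i\<close> in
  \<open>{0..<1}\<close>, so it comes out as a constant.\<close>

lemma nn_integral_circ_dist_gt:
  fixes I :: "'i set"
  assumes I: "finite I" "i \<in> I" "j \<in> I" "i \<noteq> j" and t: "0 \<le> t"
    and h[measurable]: "h \<in> borel_measurable (PiM I (\<lambda>_. circle_law))"
    and indep: "\<And>z y. h (z(j := y)) = h z"
  shows "(\<integral>\<^sup>+z. indicator {z. t < circ_dist (z i) (z j)} z * h z \<partial>PiM I (\<lambda>_. circle_law))
    = ennreal (max 0 (1 - 2 * t)) * (\<integral>\<^sup>+z. h z \<partial>PiM I (\<lambda>_. circle_law))"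
proof -
  interpret prob_space circle_law by (rule prob_space_circle_law)
  interpret C: product_sigma_finite "\<lambda>_::'i. circle_law"
    by (simp add: product_sigma_finite_def prob_space_imp_sigma_finite prob_space_circle_law)
  let ?c = "ennreal (max 0 (1 - 2 * t))"
  define J where "J = I - {j}"
  have J: "finite J" "j \<notin> J" "I = insert j J" "i \<in> J"
    using I by (auto simp: J_def)
  have h': "h \<in> borel_measurable (PiM J (\<lambda>_. circle_law))"
  proof -
    \<comment> \<open>Freezing coordinate \<open>j\<close> at the arbitrary value 0 leaves
      \<open>h\<close> unchanged and moves its measurability to the product without
      \<open>j\<close>.\<close>
    have "(\<lambda>x. x(j := 0)) \<in> PiM J (\<lambda>_. circle_law) \<rightarrow>\<^sub>M PiM I (\<lambda>_. circle_law)"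
      unfolding J(3) by (rule measurable_fun_upd[where J = J]) auto
    from measurable_compose[OF this h] show ?thesis
      by (simp add: indep)
  qed
  have ind: "(\<lambda>z. indicator {z. t < circ_dist (z i) (z j)} z :: ennreal) \<in> borel_measurable (PiM I (\<lambda>_. circle_law))"
  proof -
    have [measurable]: "(\<lambda>z. z i) \<in> borel_measurable (PiM I (\<lambda>_. circle_law))"
      "(\<lambda>z. z j) \<in> borel_measurable (PiM I (\<lambda>_. circle_law))"
      using measurable_component_singleton[of _ I "\<lambda>_. circle_law"] I
      by (simp_all cong: measurable_cong_sets)
    show ?thesis
      by measurable
  qed
  have "(\<integral>\<^sup>+z. indicator {z. t < circ_dist (z i) (z j)} z * h z \<partial>PiM I (\<lambda>_. circle_law))
      = (\<integral>\<^sup>+x. \<integral>\<^sup>+y. indicator {y. t < circ_dist (x i) y} y * h x \<partial>circle_law \<partial>PiM J (\<lambda>_. circle_law))"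
    using ind h I(4) unfolding J(3)
    by (subst C.product_nn_integral_insert[OF J(1,2)]) (auto simp: indep indicator_def)
  also have "\<dots> = (\<integral>\<^sup>+x. ?c * h x \<partial>PiM J (\<lambda>_. circle_law))"
  proof (rule nn_integral_cong_AE)
    have "AE x in PiM J (\<lambda>_. circle_law). 0 \<le> x i \<and> x i < 1"
      using AE_PiM_component[OF prob_space_circle_law J(4) AE_circle_law] .
    then show "AE x in PiM J (\<lambda>_. circle_law).
        (\<integral>\<^sup>+y. indicator {y. t < circ_dist (x i) y} y * h x \<partial>circle_law) = ?c * h x"
      by eventually_elim (simp add: nn_integral_multc emeasure_circ_dist_gt t)
  qed
  also have "\<dots> = ?c * (\<integral>\<^sup>+x. h x \<partial>PiM J (\<lambda>_. circle_law))"
    by (rule nn_integral_cmult[OF h'])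
  also have "(\<integral>\<^sup>+x. h x \<partial>PiM J (\<lambda>_. circle_law)) = (\<integral>\<^sup>+z. h z \<partial>PiM I (\<lambda>_. circle_law))"
    using h unfolding J(3)
    by (subst C.product_nn_integral_insert[OF J(1,2)]) (auto simp: indep emeasure_space_1[simplified])
  finally show ?thesis .
qed

lemma sets_circ_dist_gt [measurable]:
  assumes "i \<in> I" "j \<in> I"
  shows "{z \<in> space (PiM I (\<lambda>_. circle_law)). t < circ_dist (z i) (z j)} \<in> sets (PiM I (\<lambda>_. circle_law))"
proof -
  have [measurable]: "(\<lambda>z. z i) \<in> borel_measurable (PiM I (\<lambda>_. circle_law))"
    "(\<lambda>z. z j) \<in> borel_measurable (PiM I (\<lambda>_. circle_law))"
    using measurable_component_singleton[of _ I "\<lambda>_. circle_law"] assms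
    by (simp_all cong: measurable_cong_sets)
  show ?thesis
    by measurable
qed

text \<open>Independence from any event that does not look at \<open>j\<close>. Only the trace of
  \<open>D\<close> on the space has to be measurable, so \<open>UNIV\<close> or a bare comprehension
  can be inserted, for which invariance under changing \<open>j\<close> is immediate.\<close>

lemma prob_circ_dist_gt_Int:
  fixes I :: "'i set" and D :: "('i \<Rightarrow> real) set"
  defines "N \<equiv> PiM I (\<lambda>_. circle_law)"
  assumes I: "finite I" "i \<in> I" "j \<in> I" "i \<noteq> j" and t: "0 \<le> t"
    and D: "D \<inter> space N \<in> sets N" and indep: "\<And>z y. z(j := y) \<in> D \<longleftrightarrow> z \<in> D"
  shows "measure N ({z \<in> space N. t < circ_dist (z i) (z j)} \<inter> D) = max 0 (1 - 2 * t) * measure N (D \<inter> space N)"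
proof -
  interpret N: prob_space N
    unfolding N_def by (intro prob_space_PiM prob_space_circle_law)
  let ?B = "{z \<in> space N. t < circ_dist (z i) (z j)}"
  have B: "?B \<in> sets N"
    unfolding N_def using I by (intro sets_circ_dist_gt)
  have BD: "?B \<inter> D \<in> sets N"
    using sets.Int[OF B D] by (simp add: Int_def conj.commute conj.left_commute cong: conj_cong)
  have h: "(indicator D :: _ \<Rightarrow> ennreal) \<in> borel_measurable N"
  proof -
    have "(indicator (D \<inter> space N) :: _ \<Rightarrow> ennreal) \<in> borel_measurable N"
      using D by simp
    then show ?thesis
      by (rule measurable_cong[THEN iffD1, rotated]) (auto simp: indicator_def)
  qed
  have "emeasure N (?B \<inter> D) = (\<integral>\<^sup>+z. indicator (?B \<inter> D) z \<partial>N)"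
    using BD by simp
  also have "\<dots> = (\<integral>\<^sup>+z. indicator {z. t < circ_dist (z i) (z j)} z * indicator D z \<partial>N)"
    by (intro nn_integral_cong) (auto simp: indicator_def)
  also have "\<dots> = ennreal (max 0 (1 - 2 * t)) * (\<integral>\<^sup>+z. indicator D z \<partial>N)"
    unfolding N_def
    by (rule nn_integral_circ_dist_gt[OF I t h[unfolded N_def]]) (simp add: indicator_def indep)
  also have "(\<integral>\<^sup>+z. indicator D z \<partial>N) = (\<integral>\<^sup>+z. indicator (D \<inter> space N) z \<partial>N)"
    by (intro nn_integral_cong) (auto simp: indicator_def)
  also have "\<dots> = emeasure N (D \<inter> space N)"
    using D by simp
  finally have *: "emeasure N (?B \<inter> D) = ennreal (max 0 (1 - 2 * t)) * emeasure N (D \<inter> space N)" .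
  define c where "c = max 0 (1 - 2 * t)"
  have "0 \<le> c"
    by (simp add: c_def)
  with * show ?thesis
    unfolding c_def[symmetric] by (simp add: measure_def enn2real_mult)
qed

text \<open>Of two different pairs, each has an endpoint outside the other. Integrating such an
  endpoint first yields the product, even when the pairs share a vertex.\<close>

lemma prob_circ_dist_gt_pair:
  fixes I :: "'i set"
  defines "N \<equiv> PiM I (\<lambda>_. circle_law)"
  defines "far \<equiv> \<lambda>i j t. {z \<in> space N. t < circ_dist (z i) (z j)}"
  assumes I: "finite I" and ij: "i \<in> I" "j \<in> I" "i \<noteq> j" and t: "0 \<le> t"
  shows "measure N (far i j t) = max 0 (1 - 2 * t)"
    and "\<lbrakk>a \<in> I; b \<in> I; a \<noteq> b; 0 \<le> s; {i, j} \<noteq> {a, b}\<rbrakk>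
      \<Longrightarrow> measure N (far i j t \<inter> far a b s) = max 0 (1 - 2 * t) * max 0 (1 - 2 * s)"
proof -
  interpret N: prob_space N
    unfolding N_def by (intro prob_space_PiM prob_space_circle_law)
  have far_commute: "far i j t = far j i t" for i j t
    unfolding far_def by (simp add: circ_dist_commute)
  have far_sets: "far i j t \<in> sets N" if "i \<in> I" "j \<in> I" for i j t
    unfolding far_def N_def using that by (rule sets_circ_dist_gt)
  have one: "measure N (far i j t) = max 0 (1 - 2 * t)"
    if "i \<in> I" "j \<in> I" "i \<noteq> j" "0 \<le> t" for i j t
    using prob_circ_dist_gt_Int[OF I that, of UNIV]
    by (simp add: far_def N_def[symmetric] N.prob_space)
  then show "measure N (far i j t) = max 0 (1 - 2 * t)"
    using ij t by auto
  have two: "measure N (far i j t \<inter> far a b s) = max 0 (1 - 2 * t) * max 0 (1 - 2 * s)"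
    if i: "i \<in> I" "j \<in> I" "i \<noteq> j" "0 \<le> t" and a: "a \<in> I" "b \<in> I" "a \<noteq> b" "0 \<le> s" "j \<noteq> a" "j \<noteq> b"
    for i j a b t s
  proof -
    let ?D = "{z. s < circ_dist (z a) (z b)}"
    have D: "?D \<inter> space N = far a b s"
      by (auto simp: far_def)
    have "measure N ({z \<in> space N. t < circ_dist (z i) (z j)} \<inter> ?D)
        = max 0 (1 - 2 * t) * measure N (?D \<inter> space N)"
      unfolding N_def
      by (rule prob_circ_dist_gt_Int[OF I i])
         (use a far_sets D in \<open>auto simp: N_def[symmetric]\<close>)
    moreover have "{z \<in> space N. t < circ_dist (z i) (z j)} \<inter> ?D = far i j t \<inter> far a b s"
      by (auto simp: far_def)
    ultimately show ?thesis
      by (simp add: D one a)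
  qed
  assume a: "a \<in> I" "b \<in> I" "a \<noteq> b" "0 \<le> s" "{i, j} \<noteq> {a, b}"
  \<comment> \<open>Both pairs have two elements and differ, so \<open>i\<close> or \<open>j\<close>
    lies outside \<open>{a, b}\<close>. The second case becomes the first after swapping
    \<open>i\<close> and \<open>j\<close>.\<close>
  then consider "j \<noteq> a" "j \<noteq> b" | "i \<noteq> a" "i \<noteq> b"
    using ij by blast
  then show "measure N (far i j t \<inter> far a b s) = max 0 (1 - 2 * t) * max 0 (1 - 2 * s)"
  proof cases
    case 1
    then show ?thesis using two ij t a by auto
  next
    case 2
    then show ?thesis
      using two[of j i t a b s] ij t a by (auto simp: far_commute[of i j])
  qed
qed

text \<open>The complement is the union of the far-apart events, to which the Bonferroni bound
  applies. Injectivity on unordered pairs keeps distinct indices from naming the same pair, which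
  would destroy independence.\<close>

lemma prob_all_circ_dist_le:
  fixes I :: "'i set" and E :: "'e set"
  defines "N \<equiv> PiM I (\<lambda>_. circle_law)"
  assumes I: "finite I" and E: "finite E"
    and ends: "\<And>e. e \<in> E \<Longrightarrow> a e \<in> I \<and> b e \<in> I \<and> a e \<noteq> b e"
    and inj: "inj_on (\<lambda>e. {a e, b e}) E"
    and t: "\<And>e. e \<in> E \<Longrightarrow> 0 \<le> t e"
  defines "S \<equiv> \<Sum>e\<in>E. max 0 (1 - 2 * t e)"
  shows "measure N {z \<in> space N. \<forall>e\<in>E. circ_dist (z (a e)) (z (b e)) \<le> t e} \<le> 1 - S + S\<^sup>2 / 2"
proof -
  interpret N: prob_space N
    unfolding N_def by (intro prob_space_PiM prob_space_circle_law)
  define B where "B e = {z \<in> space N. t e < circ_dist (z (a e)) (z (b e))}" for e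
  have B: "B e \<in> sets N" if "e \<in> E" for e
    unfolding B_def N_def using ends[OF that] by (intro sets_circ_dist_gt) auto
  have "S - S\<^sup>2 / 2 \<le> measure N (\<Union>e\<in>E. B e)"
    unfolding S_def
  proof (rule N.prob_Union_ge_pairwise_indep[OF E B])
    show "measure N (B e) = max 0 (1 - 2 * t e)" if "e \<in> E" for e
      unfolding B_def N_def using ends[OF that] t[OF that] I
      by (intro prob_circ_dist_gt_pair(1)) auto
    show "measure N (B e \<inter> B e') = max 0 (1 - 2 * t e) * max 0 (1 - 2 * t e')"
      if e: "e \<in> E" "e' \<in> E" "e \<noteq> e'" for e e'
      unfolding B_def N_def using ends[OF e(1)] ends[OF e(2)] t[OF e(1)] t[OF e(2)] I
        inj_on_contraD[OF inj e(3,1,2)]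
      by (intro prob_circ_dist_gt_pair(2)) auto
  qed
  also have "measure N (\<Union>e\<in>E. B e) = 1 - measure N (space N - (\<Union>e\<in>E. B e))"
    using B E by (subst N.prob_compl) auto
  also have "space N - (\<Union>e\<in>E. B e) = {z \<in> space N. \<forall>e\<in>E. circ_dist (z (a e)) (z (b e)) \<le> t e}"
    by (auto simp: B_def not_less)
  finally show ?thesis
    by simp
qed

section \<open>An elementary inequality for the correction factor\<close>

text \<open>For \<open>x = r * y\<close> in the unit interval,
  \<open>exp (- x) \<le> 1 / (1 + x) \<le> 1 - x / 2\<close>, and then
  \<open>1 - exp (- y) \<le> y\<close> is used. With \<open>q = exp (- y)\<close> it reads
  \<open>q powr r \<le> 1 - c * (1 - q) / 2\<close>; later \<open>c\<close> is the number of
  pairs.\<close>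

lemma exp_neg_mult_le:
  fixes c r y :: real
  assumes "0 \<le> c" "c \<le> r" "0 < r" "0 \<le> y" "r * y \<le> 1"
  shows "exp (- (r * y)) \<le> 1 - c * (1 - exp (- y)) / 2"
proof -
  have "exp (- (r * y)) \<le> 1 / (1 + r * y)"
    using exp_ge_add_one_self[of "r * y"] assms
    by (simp add: exp_minus inverse_eq_divide frac_le add_pos_nonneg)
  also have "\<dots> \<le> 1 - r * y / 2"
  proof -
    have "(r * y) * (r * y) \<le> r * y * 1"
      using assms by (intro mult_left_mono) auto
    then have "1 \<le> (1 - r * y / 2) * (1 + r * y)"
      by (simp add: algebra_simps)
    then show ?thesis
      using assms by (simp add: pos_divide_le_eq add_pos_nonneg)
  qed
  also have "r * y \<ge> c * (1 - exp (- y))"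
    using assms exp_ge_add_one_self[of "- y"] by (intro mult_mono) auto
  then have "1 - r * y / 2 \<le> 1 - c * (1 - exp (- y)) / 2"
    by simp
  finally show ?thesis .
qed

section \<open>The law of the weights\<close>

text \<open>The function in \<open>weight_law\<close> is monotone and right-continuous with limits 0
  and 1, hence a distribution function. It vanishes at \<open>w0\<close>, so \<open>w0\<close>
  carries no atom and the bound is strict almost everywhere.\<close>

lemma
  assumes "0 < w0" "1 < \<beta>"
  shows prob_space_weight_law: "prob_space (weight_law \<beta> w0)"
    and AE_weight_law: "AE x in weight_law \<beta> w0. w0 < x"
proof -
  define F where "F x = (if x < w0 then 0 else 1 - (x / w0) powr (1 - \<beta>))" for x
  have law: "weight_law \<beta> w0 = interval_measure F"
    by (simp add: weight_law_def F_def[abs_def])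
  have F_mono: "F x \<le> F y" if "x \<le> y" for x y
  proof -
    have "(y / w0) powr (1 - \<beta>) \<le> (x / w0) powr (1 - \<beta>)" if "w0 \<le> x"
      using that \<open>x \<le> y\<close> assms by (intro powr_mono2') (auto simp: divide_simps)
    moreover have "(y / w0) powr (1 - \<beta>) \<le> 1" if "w0 \<le> y"
      using powr_mono2'[of "1 - \<beta>" 1 "y / w0"] that assms by simp
    ultimately show ?thesis
      using that by (auto simp: F_def)
  qed
  \<comment> \<open>Clamping the argument at \<open>w0\<close> merges the two branches into one
    formula, to which the continuity rules apply.\<close>
  have F_max: "F = (\<lambda>x. 1 - (max x w0 / w0) powr (1 - \<beta>))"
    using assms by (auto simp: F_def fun_eq_iff max_def)
  have F_cont: "continuous (at_right a) F" for a
    unfolding F_max using assms by (intro continuous_intros) (auto simp: max_def)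
  have F_bot: "(F \<longlongrightarrow> 0) at_bot"
    by (rule tendsto_eventually)
       (auto simp: F_def eventually_at_bot_linorder intro!: exI[of _ "w0 - 1"])
  have "((\<lambda>x. 1 - (x / w0) powr (1 - \<beta>)) \<longlongrightarrow> 1 - 0) at_top"
    using assms
    by (intro tendsto_intros tendsto_neg_powr
          filterlim_tendsto_pos_mult_at_top[OF tendsto_const[of "1 / w0"] _ filterlim_ident, simplified]) auto
  then have "(F \<longlongrightarrow> 1 - 0) at_top"
    by (rule Lim_transform_eventually)
       (auto simp: F_def eventually_at_top_linorder intro!: exI[of _ w0])
  then have F_top: "(F \<longlongrightarrow> 1) at_top"
    by simp
  interpret real_distribution "interval_measure F"
    using F_mono F_cont F_bot F_top by (rule real_distribution_interval_measure)
  show "prob_space (weight_law \<beta> w0)"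
    unfolding law by (rule prob_space_axioms)
  have "prob {..w0} = F w0"
    using cdf_interval_measure[OF F_mono F_cont F_bot] by (simp add: cdf_def fun_eq_iff)
  also have "\<dots> = 0"
    using assms by (simp add: F_def)
  finally have "{..w0} \<in> null_sets (interval_measure F)"
    by (auto simp: emeasure_eq_measure)
  then show "AE x in weight_law \<beta> w0. w0 < x"
    unfolding law by (rule AE_I') (auto simp: not_less)
qed

section \<open>Edge events, coordinate by coordinate\<close>

lemma torus_dist_commute: "torus_dist d x y = torus_dist d y x"
  by (simp add: torus_dist_def circ_dist_commute)

lemma torus_dist_le_iff:
  "0 < d \<Longrightarrow> torus_dist d x y \<le> t \<longleftrightarrow> (\<forall>l\<in>{1..d}. circ_dist (x l) (y l) \<le> t)"
  unfolding torus_dist_def by (subst Max_le_iff) auto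

lemma mem_girg_edges_iff:
  "{a, b} \<in> girg_edges lam n d w x \<longleftrightarrow> a \<in> {1..n} \<and> b \<in> {1..n} \<and> a \<noteq> b \<and>
    torus_dist d (x a) (x b) \<le> 1 / 2 * (lam * w a * w b / real n) powr (1 / real d)"
proof -
  have *: "lam * w b * w a = lam * w a * w b"
    by simp
  show ?thesis
    unfolding girg_edges_def by (auto simp: doubleton_eq_iff torus_dist_commute *)
qed

abbreviation samples :: "nat \<Rightarrow> nat \<Rightarrow> (nat \<Rightarrow> nat) set" where
  "samples n k \<equiv> {v \<in> {1..k} \<rightarrow>\<^sub>E {1..n}. inj_on v {1..k}}"

text \<open>Injectivity of \<open>v\<close> settles membership and distinctness of the endpoints, so
  only distances remain. The maximum distance is bounded exactly when every coordinate distance is,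
  which splits the event by coordinates.\<close>

lemma contains_edges_iff:
  assumes d: "0 < d" and A: "A \<subseteq> index_pairs k" and v: "v \<in> samples n k"
  shows "contains_edges lam n d k A (w, x, v) \<longleftrightarrow>
    (\<forall>e\<in>A. \<forall>l\<in>{1..d}. circ_dist (x (v (fst e)) l) (x (v (snd e)) l)
      \<le> 1 / 2 * (lam * w (v (fst e)) * w (v (snd e)) / real n) powr (1 / real d))"
proof -
  have "{v i, v j} \<in> induced_edges (girg_edges lam n d w x) (v ` {1..k}) \<longleftrightarrow>
      (\<forall>l\<in>{1..d}. circ_dist (x (v i) l) (x (v j) l)
        \<le> 1 / 2 * (lam * w (v i) * w (v j) / real n) powr (1 / real d))"
    if "(i, j) \<in> A" for i j
  proof -
    have ij: "i \<in> {1..k}" "j \<in> {1..k}" "i \<noteq> j"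
      using A that by (auto simp: index_pairs_def)
    then have "v i \<in> {1..n}" "v j \<in> {1..n}" "v i \<noteq> v j"
      using v by (auto simp: inj_on_eq_iff dest: PiE_mem)
    with ij show ?thesis
      unfolding torus_dist_le_iff[OF d, symmetric]
      by (simp add: induced_edges_def mem_girg_edges_iff)
  qed
  then show ?thesis
    unfolding contains_edges_def by (simp add: image_subset_iff split_beta)
qed

lemma finite_index_pairs: "finite (index_pairs k)"
  by (rule finite_subset[of _ "{1..k} \<times> {1..k}"]) (auto simp: index_pairs_def)

text \<open>Ordered pairs are counted, which loses a factor of two; this is harmless, as the count
  is only compared with \<open>r\<close>.\<close>

lemma card_index_pairs_le: "card (index_pairs k) \<le> k * (k - 1)"
proof -
  have "index_pairs k \<subseteq> Sigma {1..k} (\<lambda>i. {1..k} - {i})"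
    by (auto simp: index_pairs_def)
  then have "card (index_pairs k) \<le> card (Sigma {1..k} (\<lambda>i. {1..k} - {i}))"
    by (intro card_mono) auto
  also have "\<dots> = k * (k - 1)"
    by simp
  finally show ?thesis .
qed

text \<open>With weights and sample fixed, the event imposes one and the same condition
  \<open>Q\<close> on each coordinate slice of the positions. The slices are independent with a
  common law, so the probability is a \<open>d\<close>-th power whose base Bonferroni
  controls.\<close>

lemma nn_integral_contains_edges_le:
  fixes lam :: real and w :: "nat \<Rightarrow> real"
  assumes d: "0 < d" and A: "A \<subseteq> index_pairs k" and v: "v \<in> samples n k"
  defines "S \<equiv> \<Sum>e\<in>A. max 0 (1 - (lam * w (v (fst e)) * w (v (snd e)) / real n) powr (1 / real d))"
  shows "(\<integral>\<^sup>+x. indicator {x. contains_edges lam n d k A (w, x, v)} x \<partial>PiM {1..n} (\<lambda>_. torus_law d))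
    \<le> ennreal ((1 - S + S\<^sup>2 / 2) ^ d)"
proof -
  let ?N = "PiM {1..n} (\<lambda>_. circle_law)"
  interpret N: prob_space ?N
    by (intro prob_space_PiM prob_space_circle_law)
  \<comment> \<open>The factor \<open>1 / 2\<close> in the radius cancels the 2 from the two sides
    of the arc, so \<open>max 0 (1 - 2 * t e)\<close> is the summand of \<open>S\<close>.\<close>
  define t where "t e = 1 / 2 * (lam * w (v (fst e)) * w (v (snd e)) / real n) powr (1 / real d)" for e
  define Q where "Q = {z \<in> space ?N. \<forall>e\<in>A. circ_dist (z (v (fst e))) (z (v (snd e))) \<le> t e}"
  have fin: "finite A"
    using A finite_index_pairs by (rule finite_subset)
  have ends: "v (fst e) \<in> {1..n} \<and> v (snd e) \<in> {1..n} \<and> v (fst e) \<noteq> v (snd e)" if "e \<in> A" for e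
  proof -
    have "fst e \<in> {1..k}" "snd e \<in> {1..k}" "fst e \<noteq> snd e"
      using A that by (auto simp: index_pairs_def)
    then show ?thesis
      using v by (auto simp: inj_on_eq_iff dest: PiE_mem)
  qed
  \<comment> \<open>Injectivity of \<open>v\<close> recovers the set of indices from the set of
    vertices, and the order \<open>fst e < snd e\<close> recovers the pair from that set.\<close>
  have inj: "inj_on (\<lambda>e. {v (fst e), v (snd e)}) A"
  proof (rule inj_onI)
    fix e e' assume e: "e \<in> A" "e' \<in> A" and eq: "{v (fst e), v (snd e)} = {v (fst e'), v (snd e')}"
    have "v ` {fst e, snd e} = v ` {fst e', snd e'}"
      using eq by simp
    moreover have "{fst e, snd e} \<subseteq> {1..k}" "{fst e', snd e'} \<subseteq> {1..k}" "fst e < snd e" "fst e' < snd e'"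
      using A e by (auto simp: index_pairs_def)
    ultimately have "{fst e, snd e} = {fst e', snd e'}"
      using v by (subst (asm) inj_on_image_eq_iff[of v "{1..k}"]) auto
    with \<open>fst e < snd e\<close> \<open>fst e' < snd e'\<close> show "e = e'"
      by (auto simp: doubleton_eq_iff prod_eq_iff)
  qed
  have "Q = space ?N - (\<Union>e\<in>A. {z \<in> space ?N. t e < circ_dist (z (v (fst e))) (z (v (snd e)))})"
    by (auto simp: Q_def not_less)
  also have "\<dots> \<in> sets ?N"
    using fin ends by (intro sets.Diff sets.top sets.finite_UN sets_circ_dist_gt) auto
  finally have Q: "Q \<in> sets ?N" .
  have "(\<integral>\<^sup>+x. indicator {x. contains_edges lam n d k A (w, x, v)} x \<partial>PiM {1..n} (\<lambda>_. torus_law d))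
      = (\<integral>\<^sup>+x. (\<Prod>l\<in>{1..d}. indicator Q (\<lambda>u\<in>{1..n}. x u l)) \<partial>PiM {1..n} (\<lambda>_. PiM {1..d} (\<lambda>_. circle_law)))"
    unfolding torus_law_eq_PiM
  proof (intro nn_integral_cong)
    fix x :: "nat \<Rightarrow> nat \<Rightarrow> real"
    have "(\<lambda>u\<in>{1..n}. x u l) \<in> Q \<longleftrightarrow>
        (\<forall>e\<in>A. circ_dist (x (v (fst e)) l) (x (v (snd e)) l) \<le> t e)" for l
      using ends by (simp add: Q_def space_PiM cong: ball_cong)
    then have "contains_edges lam n d k A (w, x, v) \<longleftrightarrow> (\<forall>l\<in>{1..d}. (\<lambda>u\<in>{1..n}. x u l) \<in> Q)"
      unfolding contains_edges_iff[OF d A v] t_def[symmetric] by blast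
    then show "indicator {x. contains_edges lam n d k A (w, x, v)} x
        = (\<Prod>l\<in>{1..d}. indicator Q (\<lambda>u\<in>{1..n}. x u l) :: ennreal)"
      by (auto simp: indicator_def prod_zero_iff[symmetric] intro!: prod.neutral[symmetric])
  qed
  also have "\<dots> = (\<Prod>l\<in>{1..d}. \<integral>\<^sup>+z. indicator Q z \<partial>?N)"
    using Q by (intro nn_integral_prod_coordinates prob_space_circle_law) auto
  also have "\<dots> = ennreal (measure ?N Q ^ d)"
    using Q by (simp only: nn_integral_indicator N.emeasure_eq_measure prod_constant)
      (simp add: ennreal_power)
  also have "\<dots> \<le> ennreal ((1 - S + S\<^sup>2 / 2) ^ d)"
  proof (intro ennreal_leI power_mono)
    have "measure ?N Q \<le> 1 - (\<Sum>e\<in>A. max 0 (1 - 2 * t e)) + (\<Sum>e\<in>A. max 0 (1 - 2 * t e))\<^sup>2 / 2"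
      unfolding Q_def by (rule prob_all_circ_dist_le[OF _ fin ends inj]) (auto simp: t_def)
    also have "(\<Sum>e\<in>A. max 0 (1 - 2 * t e)) = S"
      by (simp add: S_def t_def)
    finally show "measure ?N Q \<le> 1 - S + S\<^sup>2 / 2" .
  qed simp
  finally show ?thesis .
qed

section \<open>The space of outcomes and measurability on it\<close>

lemma prob_space_girg_space:
  assumes "0 < w0" "1 < \<beta>" "k \<le> n"
  shows "prob_space (girg_space \<beta> w0 n d k)"
    and "prob_space (PiM {1..n} (\<lambda>_. weight_law \<beta> w0))"
    and "prob_space (PiM {1..n} (\<lambda>_. torus_law d))"
    and "prob_space (uniform_count_measure (samples n k))"
proof -
  show W: "prob_space (PiM {1..n} (\<lambda>_. weight_law \<beta> w0))"
    using assms by (intro prob_space_PiM prob_space_weight_law)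
  show X: "prob_space (PiM {1..n} (\<lambda>_. torus_law d))"
    unfolding torus_law_eq_PiM by (intro prob_space_PiM prob_space_circle_law)
  \<comment> \<open>The identity tuple, available because \<open>k \<le> n\<close>, shows that the
    uniform law of the sample is over a nonempty set.\<close>
  have "restrict id {1..k} \<in> samples n k"
    using assms by (auto simp: inj_on_def)
  moreover have "finite (samples n k)"
    by (rule finite_subset[of _ "{1..k} \<rightarrow>\<^sub>E {1..n}"]) (auto intro!: finite_PiE)
  ultimately show V: "prob_space (uniform_count_measure (samples n k))"
    by (metis (lifting) prob_space_uniform_count_measure empty_iff)
  show "prob_space (girg_space \<beta> w0 n d k)"
    unfolding girg_space_def using W X V by (intro prob_space_pair)
qed

lemma space_girg_space:
  "space (girg_space \<beta> w0 n d k) = space (PiM {1..n} (\<lambda>_. weight_law \<beta> w0)) \<times>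
     space (PiM {1..n} (\<lambda>_. torus_law d)) \<times> samples n k"
  by (simp add: girg_space_def space_pair_measure space_uniform_count_measure)

lemma measurable_sample:
  assumes "i \<in> {1..k}"
  shows "(\<lambda>\<omega>. snd (snd \<omega>) i) \<in> girg_space \<beta> w0 n d k \<rightarrow>\<^sub>M count_space {1..n}"
proof -
  have "(\<lambda>v. v i) \<in> uniform_count_measure (samples n k) \<rightarrow>\<^sub>M count_space {1..n}"
    unfolding measurable_cong_sets[OF sets_uniform_count_measure_count_space refl] measurable_count_space_eq1
    using assms by auto
  then show ?thesis
    unfolding girg_space_def by measurable
qed

text \<open>The vertex whose weight is read is itself random, but it takes finitely many values, so
  measurability need only be checked for each fixed vertex.\<close>

lemma measurable_sample_weight:
  assumes "i \<in> {1..k}"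
  shows "(\<lambda>\<omega>. fst \<omega> (snd (snd \<omega>) i)) \<in> borel_measurable (girg_space \<beta> w0 n d k)"
proof (rule measurable_compose_countable'[where f = "\<lambda>u \<omega>. fst \<omega> u", OF _ measurable_sample[OF assms]])
  fix u assume "u \<in> {1..n}"
  then have "(\<lambda>w. w u) \<in> PiM {1..n} (\<lambda>_. weight_law \<beta> w0) \<rightarrow>\<^sub>M weight_law \<beta> w0"
    by (rule measurable_component_singleton)
  then have "(\<lambda>w. w u) \<in> borel_measurable (PiM {1..n} (\<lambda>_. weight_law \<beta> w0))"
    by (simp add: weight_law_def cong: measurable_cong_sets)
  then show "(\<lambda>\<omega>. fst \<omega> u) \<in> borel_measurable (girg_space \<beta> w0 n d k)"
    unfolding girg_space_def by (rule measurable_compose[OF measurable_fst])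
qed simp

lemma measurable_sample_position:
  assumes "i \<in> {1..k}" "l \<in> {1..d}"
  shows "(\<lambda>\<omega>. fst (snd \<omega>) (snd (snd \<omega>) i) l) \<in> borel_measurable (girg_space \<beta> w0 n d k)"
proof (rule measurable_compose_countable'[where f = "\<lambda>u \<omega>. fst (snd \<omega>) u l", OF _ measurable_sample[OF assms(1)]])
  fix u assume "u \<in> {1..n}"
  then have 1: "(\<lambda>x. x u) \<in> PiM {1..n} (\<lambda>_. torus_law d) \<rightarrow>\<^sub>M torus_law d"
    by (rule measurable_component_singleton)
  have "(\<lambda>y. y l) \<in> torus_law d \<rightarrow>\<^sub>M circle_law"
    unfolding torus_law_eq_PiM using assms(2) by (rule measurable_component_singleton)
  from measurable_compose[OF 1 this]
  have "(\<lambda>x. x u l) \<in> borel_measurable (PiM {1..n} (\<lambda>_. torus_law d))"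
    by (simp cong: measurable_cong_sets)
  then show "(\<lambda>\<omega>. fst (snd \<omega>) u l) \<in> borel_measurable (girg_space \<beta> w0 n d k)"
    unfolding girg_space_def by measurable
qed simp

lemma sets_contains_edges:
  assumes d: "0 < d" and A: "A \<subseteq> index_pairs k"
  shows "{\<omega> \<in> space (girg_space \<beta> w0 n d k). contains_edges lam n d k A \<omega>} \<in> sets (girg_space \<beta> w0 n d k)"
proof -
  let ?M = "girg_space \<beta> w0 n d k"
  have fin: "finite A"
    using A finite_index_pairs by (rule finite_subset)
  have "{\<omega> \<in> space ?M. contains_edges lam n d k A \<omega>} =
    {\<omega> \<in> space ?M. \<forall>e\<in>A. \<forall>l\<in>{1..d}.
      circ_dist (fst (snd \<omega>) (snd (snd \<omega>) (fst e)) l) (fst (snd \<omega>) (snd (snd \<omega>) (snd e)) l)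
      \<le> 1 / 2 * (lam * fst \<omega> (snd (snd \<omega>) (fst e)) * fst \<omega> (snd (snd \<omega>) (snd e)) / real n) powr (1 / real d)}"
  proof (intro Collect_cong conj_cong refl)
    fix \<omega> assume "\<omega> \<in> space ?M"
    then have "snd (snd \<omega>) \<in> samples n k"
      by (auto simp: space_girg_space)
    from contains_edges_iff[OF d A this, of lam "fst \<omega>" "fst (snd \<omega>)"]
    show "contains_edges lam n d k A \<omega> \<longleftrightarrow> (\<forall>e\<in>A. \<forall>l\<in>{1..d}.
      circ_dist (fst (snd \<omega>) (snd (snd \<omega>) (fst e)) l) (fst (snd \<omega>) (snd (snd \<omega>) (snd e)) l)
      \<le> 1 / 2 * (lam * fst \<omega> (snd (snd \<omega>) (fst e)) * fst \<omega> (snd (snd \<omega>) (snd e)) / real n) powr (1 / real d))"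
      by (simp only: prod.collapse)
  qed
  also have "\<dots> \<in> sets ?M"
  proof (intro sets.sets_Collect_finite_All fin finite_atLeastAtMost)
    fix e l assume e: "e \<in> A" and l: "l \<in> {1..d}"
    then have "fst e \<in> {1..k}" "snd e \<in> {1..k}"
      using A by (auto simp: index_pairs_def)
    note [measurable] = measurable_sample_weight[OF this(1)] measurable_sample_weight[OF this(2)]
      measurable_sample_position[OF this(1) l] measurable_sample_position[OF this(2) l]
    show "{\<omega> \<in> space ?M.
      circ_dist (fst (snd \<omega>) (snd (snd \<omega>) (fst e)) l) (fst (snd \<omega>) (snd (snd \<omega>) (snd e)) l)
      \<le> 1 / 2 * (lam * fst \<omega> (snd (snd \<omega>) (fst e)) * fst \<omega> (snd (snd \<omega>) (snd e)) / real n) powr (1 / real d)} \<in> sets ?M"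
      by measurable
  qed
  finally show ?thesis .
qed

section \<open>The conditioning algebra and iterated integrals\<close>

lemma kappa_eq: "kappa lam n i j \<omega> = min (lam * fst \<omega> (snd (snd \<omega>) i) * fst \<omega> (snd (snd \<omega>) j)) (real n)"
  by (simp add: kappa_def split_beta)

lemma subalgebra_kappa_algebra:
  "subalgebra (girg_space \<beta> w0 n d k) (kappa_algebra lam n k (girg_space \<beta> w0 n d k))"
proof -
  let ?M = "girg_space \<beta> w0 n d k"
  have "(\<lambda>\<omega>. \<lambda>(i, j)\<in>index_pairs k. kappa lam n i j \<omega>) \<in> ?M \<rightarrow>\<^sub>M (\<Pi>\<^sub>M p\<in>index_pairs k. borel)"
  proof (rule measurable_restrict)
    fix p assume "p \<in> index_pairs k"
    then have "fst p \<in> {1..k}" "snd p \<in> {1..k}"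
      by (auto simp: index_pairs_def)
    note [measurable] = measurable_sample_weight[OF this(1)] measurable_sample_weight[OF this(2)]
    show "(\<lambda>\<omega>. case p of (i, j) \<Rightarrow> kappa lam n i j \<omega>) \<in> borel_measurable ?M"
      unfolding kappa_eq split_beta by measurable
  qed
  then show ?thesis
    unfolding subalgebra_def kappa_algebra_def
    by (simp add: sets_image_in_sets)
qed

lemma measurable_kappa:
  assumes "(i, j) \<in> index_pairs k"
  shows "kappa lam n i j \<in> borel_measurable (kappa_algebra lam n k M)"
proof -
  let ?f = "\<lambda>\<omega>. \<lambda>(i, j)\<in>index_pairs k. kappa lam n i j \<omega>"
  have "?f \<in> kappa_algebra lam n k M \<rightarrow>\<^sub>M (\<Pi>\<^sub>M p\<in>index_pairs k. borel)"
    unfolding kappa_algebra_def by (rule measurable_vimage_algebra1) (auto simp: space_PiM)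
  from measurable_compose[OF this measurable_component_singleton[OF assms]]
  show ?thesis
    using assms by simp
qed

text \<open>Every set of the algebra is a preimage under a map that never reads the positions. Its
  indicator can therefore be pulled out of an integral over positions.\<close>

lemma kappa_algebra_position_irrelevant:
  assumes "B \<in> sets (kappa_algebra lam n k M)" and "(w, x, v) \<in> space M" "(w, x', v) \<in> space M"
  shows "(w, x, v) \<in> B \<longleftrightarrow> (w, x', v) \<in> B"
proof -
  let ?f = "\<lambda>\<omega>. \<lambda>(i, j)\<in>index_pairs k. kappa lam n i j \<omega>"
  obtain C where "B = ?f -` C \<inter> space M"
    using assms(1) unfolding kappa_algebra_def
    by (subst (asm) sets_vimage_algebra2) (auto simp: space_PiM)
  moreover have "?f (w, x, v) = ?f (w, x', v)"
    by (simp add: kappa_eq)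
  ultimately show ?thesis
    using assms by simp
qed

text \<open>Tonelli with the order of sample and positions exchanged: positions become innermost, to
  be integrated while weights and sample are fixed.\<close>

lemma nn_integral_girg_space:
  assumes "0 < w0" "1 < \<beta>" "k \<le> n"
    and f: "f \<in> borel_measurable (girg_space \<beta> w0 n d k)"
  shows "integral\<^sup>N (girg_space \<beta> w0 n d k) f =
    (\<integral>\<^sup>+w. \<integral>\<^sup>+v. \<integral>\<^sup>+x. f (w, x, v) \<partial>PiM {1..n} (\<lambda>_. torus_law d)
      \<partial>uniform_count_measure (samples n k) \<partial>PiM {1..n} (\<lambda>_. weight_law \<beta> w0))"
proof -
  let ?W = "PiM {1..n} (\<lambda>_. weight_law \<beta> w0)" and ?X = "PiM {1..n} (\<lambda>_. torus_law d)"
    and ?V = "uniform_count_measure (samples n k)"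
  interpret X: prob_space ?X
    using assms by (intro prob_space_girg_space)
  interpret V: prob_space ?V
    using assms by (intro prob_space_girg_space)
  interpret P: prob_space "?X \<Otimes>\<^sub>M ?V"
    by (intro prob_space_pair X.prob_space_axioms V.prob_space_axioms)
  interpret XV: pair_sigma_finite ?X ?V
    by standard
  have f: "f \<in> borel_measurable (?W \<Otimes>\<^sub>M (?X \<Otimes>\<^sub>M ?V))"
    using f by (simp add: girg_space_def)
  have "integral\<^sup>N (girg_space \<beta> w0 n d k) f = (\<integral>\<^sup>+w. \<integral>\<^sup>+y. f (w, y) \<partial>(?X \<Otimes>\<^sub>M ?V) \<partial>?W)"
    unfolding girg_space_def using f by (rule P.nn_integral_fst[symmetric])
  also have "\<dots> = (\<integral>\<^sup>+w. \<integral>\<^sup>+v. \<integral>\<^sup>+x. f (w, x, v) \<partial>?X \<partial>?V \<partial>?W)"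
    using f by (intro nn_integral_cong XV.nn_integral_snd[symmetric, of "\<lambda>y. f (_, y)"]) (rule measurable_Pair2)
  finally show ?thesis .
qed

text \<open>The form over the weights alone serves inside iterated integrals. The form over
  outcomes, obtained through the first marginal, serves to bound functions on the whole
  space.\<close>

lemma AE_girg_space_weights:
  assumes "0 < w0" "1 < \<beta>" "k \<le> n"
  shows "AE w in PiM {1..n} (\<lambda>_. weight_law \<beta> w0). \<forall>u\<in>{1..n}. w0 < w u"
    and "AE \<omega> in girg_space \<beta> w0 n d k. \<forall>u\<in>{1..n}. w0 < fst \<omega> u"
proof -
  let ?W = "PiM {1..n} (\<lambda>_. weight_law \<beta> w0)" and ?X = "PiM {1..n} (\<lambda>_. torus_law d)"
    and ?V = "uniform_count_measure (samples n k)"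
  have "AE w in ?W. w0 < w u" if "u \<in> {1..n}" for u
    using assms that
    by (intro AE_PiM_component[where M = "\<lambda>_. weight_law \<beta> w0"] prob_space_weight_law AE_weight_law)
  then show W: "AE w in ?W. \<forall>u\<in>{1..n}. w0 < w u"
    by (intro AE_finite_allI) auto
  interpret P: prob_space "?X \<Otimes>\<^sub>M ?V"
    using prob_space_girg_space[OF assms] by (intro prob_space_pair)
  have "AE w in distr (?W \<Otimes>\<^sub>M (?X \<Otimes>\<^sub>M ?V)) ?W fst. \<forall>u\<in>{1..n}. w0 < w u"
    unfolding P.distr_pair_fst by (rule W)
  from AE_distrD[OF measurable_fst this]
  show "AE \<omega> in girg_space \<beta> w0 n d k. \<forall>u\<in>{1..n}. w0 < fst \<omega> u"
    unfolding girg_space_def .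
qed

text \<open>Capping the weight product at \<open>n\<close> caps the power at 1, which is the same as
  truncating the difference at 0. The second bound is monotonicity;
  \<open>lam * w0\<^sup>2 \<le> real n\<close> covers the capped case.\<close>

lemma kappa_powr_bounds:
  assumes "0 < lam" "0 < w0" and n: "lam * w0\<^sup>2 \<le> real n"
    and w: "\<forall>u\<in>{1..n}. w0 < w u" and v: "v \<in> samples n k" and e: "(i, j) \<in> index_pairs k"
  shows "1 - (kappa lam n i j (w, x, v) / real n) powr (1 / real d)
      = max 0 (1 - (lam * w (v i) * w (v j) / real n) powr (1 / real d))"
    and "1 - (kappa lam n i j (w, x, v) / real n) powr (1 / real d)
      \<le> 1 - (lam * w0\<^sup>2 / real n) powr (1 / real d)"
proof -
  have "i \<in> {1..k}" "j \<in> {1..k}"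
    using e by (auto simp: index_pairs_def)
  then have "v i \<in> {1..n}" "v j \<in> {1..n}"
    using v by (auto dest: PiE_mem)
  then have *: "w0 < w (v i)" "w0 < w (v j)"
    using w by auto
  have "lam * (w0 * w0) \<le> lam * (w (v i) * w (v j))"
    using * assms by (intro mult_left_mono mult_mono) auto
  then have ge: "lam * w0\<^sup>2 \<le> lam * w (v i) * w (v j)"
    by (simp add: power2_eq_square)
  have pos: "0 < lam * w0\<^sup>2"
    using assms by simp
  with n have n0: "0 < real n"
    by linarith
  show "1 - (kappa lam n i j (w, x, v) / real n) powr (1 / real d)
      \<le> 1 - (lam * w0\<^sup>2 / real n) powr (1 / real d)"
    using ge n n0 pos by (auto simp: kappa_eq intro!: powr_mono2 divide_right_mono)
  show "1 - (kappa lam n i j (w, x, v) / real n) powr (1 / real d)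
      = max 0 (1 - (lam * w (v i) * w (v j) / real n) powr (1 / real d))"
  proof (cases "lam * w (v i) * w (v j) \<le> real n")
    case True
    then have "(lam * w (v i) * w (v j) / real n) powr (1 / real d) \<le> 1"
      using ge pos n0 by (intro powr_le1) (auto simp: divide_simps)
    then show ?thesis
      using True by (simp add: kappa_eq)
  next
    case False
    then have "1 \<le> (lam * w (v i) * w (v j) / real n) powr (1 / real d)"
      using n0 by (intro ge_one_powr_ge_zero) (auto simp: divide_simps)
    then show ?thesis
      using False n0 by (simp add: kappa_eq)
  qed
qed

section \<open>The conditional bound for a fixed number of vertices\<close>

text \<open>The condition on \<open>q\<close> forces \<open>q \<le> 1 - T / 2\<close> for all
  weights above \<open>w0\<close>, where \<open>T\<close> is the sum over \<open>A\<close>;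
  multiplying by \<open>T\<close> turns the Bonferroni base into \<open>1 - q * T\<close>. The
  resulting bound is measurable in the conditioning algebra, so comparing integrals over its sets
  suffices.\<close>

lemma prob_given_contains_edges_le:
  fixes lam w0 \<beta> q :: real
  assumes lam: "0 < lam" and w0: "0 < w0" and \<beta>: "1 < \<beta>" and kn: "k \<le> n" and d: "0 < d"
    and A: "A \<subseteq> index_pairs k" and n: "lam * w0\<^sup>2 \<le> real n"
    and q: "0 \<le> q" "q \<le> 1 - real (card A) * (1 - (lam * w0\<^sup>2 / real n) powr (1 / real d)) / 2"
  defines "M \<equiv> girg_space \<beta> w0 n d k"
  shows "AE \<omega> in M. prob_given M (kappa_algebra lam n k M) (contains_edges lam n d k A) \<omega>
    \<le> (1 - q * (\<Sum>(i, j)\<in>A. 1 - (kappa lam n i j \<omega> / real n) powr (1 / real d))) ^ d"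
proof -
  let ?W = "PiM {1..n} (\<lambda>_. weight_law \<beta> w0)" and ?X = "PiM {1..n} (\<lambda>_. torus_law d)"
    and ?V = "uniform_count_measure (samples n k)"
  let ?F = "kappa_algebra lam n k M"
  define T where "T \<omega> = (\<Sum>(i, j)\<in>A. 1 - (kappa lam n i j \<omega> / real n) powr (1 / real d))" for \<omega>
  define g where "g \<omega> = (1 - q * T \<omega>) ^ d" for \<omega>
  define C where "C = {\<omega> \<in> space M. contains_edges lam n d k A \<omega>}"
  interpret prob_space M
    unfolding M_def using w0 \<beta> kn by (intro prob_space_girg_space)
  interpret X: prob_space ?X
    using w0 \<beta> kn by (intro prob_space_girg_space)
  have sub: "subalgebra M ?F"
    unfolding M_def by (rule subalgebra_kappa_algebra)
  interpret finite_measure_subalgebra M ?F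
    by standard (rule sub)
  have C: "C \<in> sets M"
    unfolding C_def M_def using d A by (rule sets_contains_edges)
  have spaceM: "space M = space ?W \<times> space ?X \<times> samples n k"
    unfolding M_def by (rule space_girg_space)
  have gF: "g \<in> borel_measurable ?F"
  proof -
    have [measurable]: "kappa lam n (fst e) (snd e) \<in> borel_measurable ?F" if "e \<in> A" for e
      using that A by (intro measurable_kappa) auto
    show ?thesis
      unfolding g_def T_def split_beta by measurable
  qed
  then have gM: "g \<in> borel_measurable M"
    by (rule measurable_from_subalg[OF sub])

  have bounds: "0 \<le> g (w, x, v)" "g (w, x, v) \<le> 1"
    "(\<integral>\<^sup>+x. indicator {x. contains_edges lam n d k A (w, x, v)} x \<partial>?X) \<le> ennreal (g (w, x, v))"
    if w: "\<forall>u\<in>{1..n}. w0 < w u" and v: "v \<in> samples n k" for w x v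
  proof -
    let ?S = "\<Sum>e\<in>A. max 0 (1 - (lam * w (v (fst e)) * w (v (snd e)) / real n) powr (1 / real d))"
    have kap: "1 - (kappa lam n (fst e) (snd e) (w, x, v) / real n) powr (1 / real d)
        = max 0 (1 - (lam * w (v (fst e)) * w (v (snd e)) / real n) powr (1 / real d))"
      "1 - (kappa lam n (fst e) (snd e) (w, x, v) / real n) powr (1 / real d)
        \<le> 1 - (lam * w0\<^sup>2 / real n) powr (1 / real d)" if "e \<in> A" for e
    proof -
      have "(fst e, snd e) \<in> index_pairs k"
        using that A by auto
      then show "1 - (kappa lam n (fst e) (snd e) (w, x, v) / real n) powr (1 / real d)
          = max 0 (1 - (lam * w (v (fst e)) * w (v (snd e)) / real n) powr (1 / real d))"
        "1 - (kappa lam n (fst e) (snd e) (w, x, v) / real n) powr (1 / real d)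
          \<le> 1 - (lam * w0\<^sup>2 / real n) powr (1 / real d)"
        using kappa_powr_bounds[OF lam w0 n w v] by blast+
    qed
    have TS: "T (w, x, v) = ?S"
      unfolding T_def split_beta by (intro sum.cong refl kap)
    have "0 \<le> T (w, x, v)"
      unfolding TS by (intro sum_nonneg) auto
    have "T (w, x, v) \<le> real (card A) * (1 - (lam * w0\<^sup>2 / real n) powr (1 / real d))"
      unfolding T_def split_beta by (intro sum_bounded_above kap)
    with q have "q \<le> 1 - T (w, x, v) / 2"
      by linarith
    from mult_right_mono[OF this \<open>0 \<le> T (w, x, v)\<close>]
    have le: "1 - ?S + ?S\<^sup>2 / 2 \<le> 1 - q * T (w, x, v)"
      unfolding TS by (simp add: power2_eq_square algebra_simps)
    \<comment> \<open>Completing the square makes the base nonnegative for every value of the sum,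
      as required for raising \<open>le\<close> to the power \<open>d\<close>.\<close>
    have "1 - s + s\<^sup>2 / 2 = ((1 - s)\<^sup>2 + 1) / 2" for s :: real
      by (simp add: power2_eq_square algebra_simps)
    then have ge: "0 \<le> 1 - ?S + ?S\<^sup>2 / 2"
      by (simp only:) simp
    show "0 \<le> g (w, x, v)"
      unfolding g_def using le ge by (intro zero_le_power) linarith
    show "g (w, x, v) \<le> 1"
      unfolding g_def using le ge q \<open>0 \<le> T (w, x, v)\<close> by (intro power_le_one) auto
    have "(\<integral>\<^sup>+x. indicator {x. contains_edges lam n d k A (w, x, v)} x \<partial>?X)
        \<le> ennreal ((1 - ?S + ?S\<^sup>2 / 2) ^ d)"
      by (rule nn_integral_contains_edges_le[OF d A v])
    also have "\<dots> \<le> ennreal (g (w, x, v))"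
      unfolding g_def by (intro ennreal_leI power_mono le ge)
    finally show "(\<integral>\<^sup>+x. indicator {x. contains_edges lam n d k A (w, x, v)} x \<partial>?X) \<le> ennreal (g (w, x, v))" .
  qed

  have g01: "AE \<omega> in M. 0 \<le> g \<omega> \<and> g \<omega> \<le> 1"
    using AE_girg_space_weights(2)[OF w0 \<beta> kn, of d, folded M_def] AE_space
    by eventually_elim (use bounds spaceM in auto)
  have g_int: "integrable M g"
    using g01 gM by (intro integrable_const_bound[where B = 1]) auto
  have f_int: "integrable M (indicat_real C)"
    using C by (intro integrable_const_bound[where B = 1]) (auto simp: indicator_def)

  \<comment> \<open>For fixed weights and sample, both the indicator of \<open>B\<close> and
    \<open>g\<close> are constant in the positions, so the comparison reduces to the bound on the
    innermost integral.\<close>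
  have main: "(\<integral>\<^sup>+\<omega>. indicator B \<omega> * indicator C \<omega> \<partial>M) \<le> (\<integral>\<^sup>+\<omega>. indicator B \<omega> * ennreal (g \<omega>) \<partial>M)"
    if B: "B \<in> sets ?F" for B
  proof -
    have BM: "B \<in> sets M"
      using B sub by (auto simp: subalgebra_def)
    have f1: "(\<lambda>\<omega>. indicator B \<omega> * indicator C \<omega> :: ennreal) \<in> borel_measurable M"
      and f2: "(\<lambda>\<omega>. indicator B \<omega> * ennreal (g \<omega>)) \<in> borel_measurable M"
      using BM C gM by auto
    have "(\<integral>\<^sup>+w. \<integral>\<^sup>+v. \<integral>\<^sup>+x. indicator B (w, x, v) * indicator C (w, x, v) \<partial>?X \<partial>?V \<partial>?W)
        \<le> (\<integral>\<^sup>+w. \<integral>\<^sup>+v. \<integral>\<^sup>+x. indicator B (w, x, v) * ennreal (g (w, x, v)) \<partial>?X \<partial>?V \<partial>?W)"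
    proof (rule nn_integral_mono_AE)
      show "AE w in ?W. (\<integral>\<^sup>+v. \<integral>\<^sup>+x. indicator B (w, x, v) * indicator C (w, x, v) \<partial>?X \<partial>?V)
          \<le> (\<integral>\<^sup>+v. \<integral>\<^sup>+x. indicator B (w, x, v) * ennreal (g (w, x, v)) \<partial>?X \<partial>?V)"
        using AE_girg_space_weights(1)[OF w0 \<beta> kn] AE_space
      proof eventually_elim
        case (elim w)
        show ?case
        proof (rule nn_integral_mono)
          fix v assume "v \<in> space ?V"
          then have v: "v \<in> samples n k"
            by (simp add: space_uniform_count_measure)
          \<comment> \<open>An arbitrary reference position, at which the quantities that do not
            depend on positions are evaluated.\<close>
          obtain x0 where x0: "x0 \<in> space ?X"
            using X.not_empty by blast
          have inM: "(w, x, v) \<in> space M" if "x \<in> space ?X" for x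
            using elim v that by (simp add: spaceM)
          have Bx: "indicator B (w, x, v) = (indicator B (w, x0, v) :: ennreal)" if "x \<in> space ?X" for x
            using kappa_algebra_position_irrelevant[OF B inM[OF that] inM[OF x0]]
            by (simp add: indicator_def)
          have gx: "g (w, x, v) = g (w, x0, v)" for x
            by (simp add: g_def T_def kappa_eq)
          have "(\<integral>\<^sup>+x. indicator B (w, x, v) * indicator C (w, x, v) \<partial>?X)
              = (\<integral>\<^sup>+x. indicator B (w, x0, v) * indicator {x. contains_edges lam n d k A (w, x, v)} x \<partial>?X)"
          proof (rule nn_integral_cong)
            fix x assume x: "x \<in> space ?X"
            show "indicator B (w, x, v) * indicator C (w, x, v)
                = (indicator B (w, x0, v) * indicator {x. contains_edges lam n d k A (w, x, v)} x :: ennreal)"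
              unfolding Bx[OF x] using inM[OF x] by (simp add: C_def indicator_def)
          qed
          also have "\<dots> \<le> indicator B (w, x0, v) * ennreal (g (w, x0, v))"
            using bounds(3)[OF elim(1) v, of x0] by (cases "(w, x0, v) \<in> B") auto
          also have "\<dots> = (\<integral>\<^sup>+x. indicator B (w, x0, v) * ennreal (g (w, x0, v)) \<partial>?X)"
            by (simp only: nn_integral_const X.emeasure_space_1 mult_1_right)
          also have "\<dots> = (\<integral>\<^sup>+x. indicator B (w, x, v) * ennreal (g (w, x, v)) \<partial>?X)"
            by (rule nn_integral_cong) (metis Bx gx)
          finally show "(\<integral>\<^sup>+x. indicator B (w, x, v) * indicator C (w, x, v) \<partial>?X)
              \<le> (\<integral>\<^sup>+x. indicator B (w, x, v) * ennreal (g (w, x, v)) \<partial>?X)" .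
        qed
      qed
    qed
    then show ?thesis
      using nn_integral_girg_space[OF w0 \<beta> kn f1[unfolded M_def]]
        nn_integral_girg_space[OF w0 \<beta> kn f2[unfolded M_def]]
      unfolding M_def by simp
  qed

  have "AE \<omega> in M. real_cond_exp M ?F (indicat_real C) \<omega> \<le> g \<omega>"
  proof (rule real_cond_exp_leI[OF f_int g_int gF])
    fix B assume B: "B \<in> sets ?F"
    then have BM: "B \<in> sets M"
      using sub by (auto simp: subalgebra_def)
    have i1: "integrable M (\<lambda>\<omega>. indicat_real B \<omega> * indicat_real C \<omega>)"
      using integrable_mult_indicator[OF BM f_int] by simp
    have i2: "integrable M (\<lambda>\<omega>. indicat_real B \<omega> * g \<omega>)"
      using integrable_mult_indicator[OF BM g_int] by simp
    have nn: "AE \<omega> in M. 0 \<le> indicat_real B \<omega> * g \<omega>"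
      using g01 by eventually_elim simp
    \<comment> \<open>The comparison is known for nonnegative integrals; integrability and almost
      sure nonnegativity carry it over to real integrals.\<close>
    have "ennreal (\<integral>\<omega>. indicat_real B \<omega> * indicat_real C \<omega> \<partial>M) = (\<integral>\<^sup>+\<omega>. indicator B \<omega> * indicator C \<omega> \<partial>M)"
      by (subst nn_integral_eq_integral[OF i1, symmetric])
         (auto intro!: nn_integral_cong simp: indicator_def)
    also have "\<dots> \<le> (\<integral>\<^sup>+\<omega>. indicator B \<omega> * ennreal (g \<omega>) \<partial>M)"
      by (rule main[OF B])
    also have "\<dots> = ennreal (\<integral>\<omega>. indicat_real B \<omega> * g \<omega> \<partial>M)"
      by (subst nn_integral_eq_integral[OF i2 nn, symmetric])
         (auto intro!: nn_integral_cong simp: indicator_def)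
    finally have "(\<integral>\<omega>. indicat_real B \<omega> * indicat_real C \<omega> \<partial>M) \<le> (\<integral>\<omega>. indicat_real B \<omega> * g \<omega> \<partial>M)"
      using integral_nonneg_AE[OF nn] by (simp only: ennreal_le_iff)
    then show "(\<integral>\<omega>\<in>B. indicat_real C \<omega> \<partial>M) \<le> (\<integral>\<omega>\<in>B. g \<omega> \<partial>M)"
      by (simp only: set_lebesgue_integral_def real_scaleR_def)
  qed
  then show ?thesis
    by (simp only: prob_given_def g_def T_def C_def)
qed

section \<open>Asymptotics: the correction factor for large \<open>n\<close>\<close>

theorem theorem22:
  fixes lam w0 \<beta> :: real and d :: "nat \<Rightarrow> nat" and k :: nat and A :: "(nat \<times> nat) set"
  assumes "lam > 0" and "w0 > 0" and "\<beta> > 2"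
    and "(\<lambda>n. real (d n)) \<in> \<omega>(\<lambda>n. ln (real n))"
    and "k \<ge> 3"
    and "A \<subseteq> index_pairs k"
  defines "r \<equiv> (3 * (real k - 2) + 1) * (real k - 1)"
    and "\<kappa>\<^sub>0 \<equiv> lam * w0\<^sup>2"
    and "M \<equiv> (\<lambda>n. girg_space \<beta> w0 n (d n) k)"
  shows "\<forall>\<^sub>F n in sequentially. AE \<omega> in M n.
    prob_given (M n) (kappa_algebra lam n k (M n)) (contains_edges lam n (d n) k A) \<omega>
      \<le> (1 - (\<kappa>\<^sub>0 / real n) powr (r / real (d n)) *
            (\<Sum>(i, j)\<in>A. (1 - (kappa lam n i j \<omega> / real n) powr (1 / real (d n))))) ^ d n"
proof -
  have k: "real k \<ge> 3"
    using assms(5) by simp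
  have "card A \<le> card (index_pairs k)"
    using assms(6) finite_index_pairs by (intro card_mono)
  also have "\<dots> \<le> k * (k - 1)"
    by (rule card_index_pairs_le)
  finally have "real (card A) \<le> real (k * (k - 1))"
    by (simp only: of_nat_le_iff)
  also have "\<dots> = real k * (real k - 1)"
    using assms(5) by simp
  \<comment> \<open>As \<open>k \<ge> 3\<close>, the factor
    \<open>3 * (k - 2) + 1 = 3 * k - 5\<close> is at least \<open>k\<close>.\<close>
  also have "\<dots> \<le> r"
    unfolding r_def using k by (intro mult_right_mono) auto
  finally have cr: "real (card A) \<le> r" .
  have r: "0 < r"
    unfolding r_def using k by (intro mult_pos_pos) auto
  have \<kappa>0: "0 < \<kappa>\<^sub>0"
    using assms by (simp add: \<kappa>\<^sub>0_def)
  \<comment> \<open>In turn: \<open>k\<close> vertices can be sampled, \<open>ln n\<close> is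
    positive, \<open>y\<close> below is nonnegative, and
    \<open>ln (n / \<kappa>\<^sub>0) \<le> 2 * ln n\<close>.\<close>
  have "\<forall>\<^sub>F n in sequentially. max (max (real k) 2) (max \<kappa>\<^sub>0 (1 / \<kappa>\<^sub>0)) \<le> real n"
    using filterlim_real_sequentially unfolding filterlim_at_top by blast
  \<comment> \<open>The constant \<open>2 * r\<close> is chosen to give \<open>r * y \<le> 1\<close>
    below: one factor is \<open>r\<close>, and the 2 comes from the bound
    \<open>2 * ln n\<close>.\<close>
  moreover have "\<forall>\<^sub>F n in sequentially. norm (real (d n)) \<ge> (2 * r) * norm (ln (real n))"
    using assms(4) by (rule smallomegaD)
  ultimately show ?thesis
  proof eventually_elim
    case (elim n)
    then have n: "k \<le> n" "2 \<le> real n" "\<kappa>\<^sub>0 \<le> real n" "1 / \<kappa>\<^sub>0 \<le> real n"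
      by auto
    have ln: "0 < ln (real n)"
      using n by simp
    have d: "2 * r * ln (real n) \<le> real (d n)"
      using elim(2) ln by simp
    then have d0: "0 < real (d n)"
      using ln r by (smt (verit) mult_pos_pos)
    \<comment> \<open>Minus the logarithm of \<open>(\<kappa>\<^sub>0 / n) powr (1 / d)\<close>, so
      that powers of \<open>\<kappa>\<^sub>0 / n\<close> become exponentials in
      \<open>y\<close>.\<close>
    define y where "y = ln (real n / \<kappa>\<^sub>0) / real (d n)"
    have "0 \<le> y"
      unfolding y_def using n \<kappa>0 d0 by (intro divide_nonneg_pos ln_ge_zero) (auto simp: divide_simps)
    have "ln (1 / \<kappa>\<^sub>0) \<le> ln (real n)"
      using n \<kappa>0 by (intro ln_mono) auto
    then have "ln (real n / \<kappa>\<^sub>0) \<le> 2 * ln (real n)"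
      using n \<kappa>0 by (simp add: ln_div)
    then have "r * ln (real n / \<kappa>\<^sub>0) \<le> r * (2 * ln (real n))"
      using r by (intro mult_left_mono) auto
    with d have "r * y \<le> 1"
      unfolding y_def using d0 by (simp add: divide_simps mult_ac)
    have powr: "(\<kappa>\<^sub>0 / real n) powr (s / real (d n)) = exp (- (s * y))" for s
      using n \<kappa>0 by (simp add: powr_def y_def ln_div right_diff_distrib diff_divide_distrib)
    \<comment> \<open>Exactly the condition on \<open>q\<close> in the fixed-\<open>n\<close> bound,
      for \<open>q = (\<kappa>\<^sub>0 / n) powr (r / d)\<close>.\<close>
    have "(\<kappa>\<^sub>0 / real n) powr (r / real (d n))
        \<le> 1 - real (card A) * (1 - (\<kappa>\<^sub>0 / real n) powr (1 / real (d n))) / 2"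
      unfolding powr using exp_neg_mult_le[OF _ cr r \<open>0 \<le> y\<close> \<open>r * y \<le> 1\<close>] by simp
    then show ?case
      unfolding M_def \<kappa>\<^sub>0_def
      using assms n d0 by (intro prob_given_contains_edges_le) auto
  qed
qed

end
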